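(* For every integer $n\ge 1$ there is a bijection $\Phi:\mathcal{P}_n\to\mathcal{M}_n$ such that for every $P\in\mathcal{P}_n$, the number of north steps of $P$ equals the number of nestings $ne(\Phi(P))$ of the matching $\Phi(P)$.
   Context: A partially directed path is a lattice path in the plane starting at the origin and consisting of unit east $(1,0)$, north $(0,1)$ and south $(0,-1)$ steps, which is self-avoiding (so a north step is never immediately followed by a south step or vice versa). $\mathcal{P}_n$ denotes the set of such paths confined to the symmetric wedge $\{(x,y): -x\le y\le x\}$, having exactly $n$ east steps and ending on the line $y=-x$ (i.e. at $(n,-n)$). Equivalently, such a path is determined by the $y$-coordinates $a_1,\dots,a_n$ of its east steps, where $a_1,\dots,a_n$ is any sequence of integers with $-(i-1)\le a_i\le i-1$. A matching on $[2n]=\{1,\dots,2n\}$ is a partition of $[2n]$ into $n$ two-element blocks (edges); $\mathcal{M}_n$ is the set of all matchings on $[2n]$. Two edges $(a,b)$, $(c,d)$ (with $a<b$, $c<d$) form a nesting if $a<c<d<b$; $ne(M)$ is the number of nestings of $M$. *)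

theory Defs
  imports Main "HOL-Library.Disjoint_Sets"
begin

datatype step = East | North | South

fun step_vec :: "step \<Rightarrow> int \<times> int" where
  "step_vec East = (1, 0)"
| "step_vec North = (0, 1)"
| "step_vec South = (0, -1)"

text \<open>The lattice points visited, in order, by the walk starting at a given point; the
  starting point is included.\<close>

fun vertices_from :: "int \<times> int \<Rightarrow> step list \<Rightarrow> (int \<times> int) list" where
  "vertices_from p [] = [p]"
| "vertices_from p (s # w) =
     p # vertices_from (fst p + fst (step_vec s), snd p + snd (step_vec s)) w"

definition vertices :: "step list \<Rightarrow> (int \<times> int) list" where
  "vertices w = vertices_from (0, 0) w"

definition partially_directed_path :: "step list \<Rightarrow> bool" where
  "partially_directed_path w \<longleftrightarrow> distinct (vertices w)"

definition wedge :: "(int \<times> int) set" where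
  "wedge = {(x, y). - x \<le> y \<and> y \<le> x}"

text \<open>The wedge is convex, so a path stays inside it as soon as its vertices do.\<close>

definition wedge_paths :: "nat \<Rightarrow> step list set" where
  "wedge_paths n =
     {w. partially_directed_path w \<and> set (vertices w) \<subseteq> wedge \<and>
         count_list w East = n \<and> last (vertices w) = (int n, - int n)}"

definition north_steps :: "step list \<Rightarrow> nat" where
  "north_steps w = count_list w North"

definition matchings :: "nat \<Rightarrow> nat set set set" where
  "matchings n = {M. partition_on {1..2 * n} M \<and> (\<forall>e\<in>M. card e = 2)}"

text \<open>Listing the outer edge first, every nested pair of edges is counted exactly once.\<close>

definition ne :: "nat set set \<Rightarrow> nat" where
  "ne M = card {((a, b), (c, d)). {a, b} \<in> M \<and> {c, d} \<in> M \<and> a < c \<and> c < d \<and> d < b}"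

end

theory Submission
  imports Defs "HOL-Computational_Algebra.Polynomial"
begin

text \<open>
  Both statistics have the generating function \<open>((D + U)^(2n) v) 0\<close>, where \<open>U\<close> and \<open>D\<close> raise
  and lower a counter, \<open>D\<close> with weight \<open>1 + q + \<dots> + q\<^sup>h\<close> on going from \<open>h + 1\<close> to \<open>h\<close>, so that
  \<open>DU = qUD + 1\<close>, and \<open>v\<close> is concentrated at \<open>0\<close>. For matchings, read the points from left to
  right and let the counter be the number of open edges: an edge closed at \<open>s\<close> picks up a factor
  \<open>q\<close> for each open vertex left of \<open>s\<close>.

  For paths, put \<open>X = D + qU\<close> and \<open>Z = D + U\<close>. The paths whose \<open>n\<close>-th east step has height
  \<open>n - 1 - c\<close> turn out to have the generating function \<open>(X^(2n - 2 - c) Z^c v) 0\<close>, which for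
  matchings is the contribution of those in which \<open>2n\<close> is joined to \<open>c + 1\<close>. Their recursion
  in \<open>n\<close> follows from \<open>X - Z = (q - 1) U\<close> and \<open>X U = 1 + q U Z\<close>.
\<close>

subsection \<open>The raising and lowering operators\<close>

definition up :: "(nat \<Rightarrow> 'a::comm_ring_1) \<Rightarrow> nat \<Rightarrow> 'a" where
  "up f h = (case h of 0 \<Rightarrow> 0 | Suc k \<Rightarrow> f k)"

text \<open>If a function is read as the coefficient sequence of a formal power series,
  \<open>up\<close> is multiplication by the variable and \<open>down\<close> is the
  q-derivative.\<close>

definition down :: "'a::comm_ring_1 \<Rightarrow> (nat \<Rightarrow> 'a) \<Rightarrow> nat \<Rightarrow> 'a" where
  "down q f h = (\<Sum>i<Suc h. q ^ i) * f (Suc h)"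

definition updown :: "'a::comm_ring_1 \<Rightarrow> 'a \<Rightarrow> (nat \<Rightarrow> 'a) \<Rightarrow> nat \<Rightarrow> 'a" where
  "updown q t f h = down q f h + t * up f h"

definition vacuum :: "nat \<Rightarrow> 'a::comm_ring_1" where
  "vacuum h = (if h = 0 then 1 else 0)"

definition mixed :: "'a::comm_ring_1 \<Rightarrow> nat \<Rightarrow> nat \<Rightarrow> 'a" where
  "mixed q a b = (updown q q ^^ a) ((updown q 1 ^^ b) vacuum) 0"

lemma down_up: "down q (up f) h = f h + q * up (down q f) h"
  by (cases h) (simp_all add: up_def down_def sum.lessThan_Suc_shift sum_distrib_left algebra_simps
      del: sum.lessThan_Suc)

lemma updown_linear:
  "updown q t (\<lambda>h. f h + c * g h) = (\<lambda>h. updown q t f h + c * updown q t g h)"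
  by (rule ext) (simp add: updown_def down_def up_def algebra_simps split: nat.split)

lemma funpow_updown_linear:
  "(updown q t ^^ a) (\<lambda>h. f h + c * g h) = (\<lambda>h. (updown q t ^^ a) f h + c * (updown q t ^^ a) g h)"
  by (induction a) (simp_all add: updown_linear)

lemma funpow_updown_add:
  "(updown q t ^^ a) (\<lambda>h. f h + g h) = (\<lambda>h. (updown q t ^^ a) f h + (updown q t ^^ a) g h)"
  using funpow_updown_linear[of a q t f 1 g] by simp

lemma updown_zero: "updown q t (\<lambda>_. 0) = (\<lambda>_. 0)"
  by (simp add: updown_def down_def up_def fun_eq_iff split: nat.split)

lemma funpow_updown_zero: "(updown q t ^^ a) (\<lambda>_. 0) = (\<lambda>_. 0)"
  by (induction a) (simp_all add: updown_zero)

text \<open>Since X U = D U + q U U, \<open>down_up\<close> turns it into 1 + q U (D + U): an X that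
  passes \<open>up\<close> becomes a Z.\<close>

lemma updown_up: "updown q q (up f) = (\<lambda>h. f h + q * up (updown q 1 f) h)"
  by (rule ext)
    (simp add: updown_def down_up, simp add: up_def updown_def algebra_simps split: nat.split)

text \<open>Dually, D Z = D D + D U = (D + q U) D + 1: a Z that passes \<open>down\<close> becomes
  an X.\<close>

lemma down_updown: "down q (updown q 1 f) = (\<lambda>h. updown q q (down q f) h + f h)"
proof
  fix h
  have "down q (updown q 1 f) h = down q (down q f) h + down q (up f) h"
    by (simp add: down_def updown_def algebra_simps)
  then show "down q (updown q 1 f) h = updown q q (down q f) h + f h"
    by (simp add: down_up updown_def)
qed

text \<open>Push \<open>up\<close> to the left: each X either absorbs it or, at the cost of a factor
  \<open>q\<close>, lets it pass and becomes a Z. The index \<open>j\<close> counts the X passed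
  before absorption; an \<open>up\<close> that passes all of them vanishes at 0.\<close>

lemma funpow_updown_up:
  "(updown q q ^^ a) (up f) 0 =
     (\<Sum>j<a. q ^ j * (updown q q ^^ (a - Suc j)) ((updown q 1 ^^ j) f) 0)"
proof (induction a arbitrary: f)
  case 0
  show ?case by (simp add: up_def)
next
  case (Suc a)
  have "(updown q q ^^ Suc a) (up f) 0 = (updown q q ^^ a) (updown q q (up f)) 0"
    by (simp add: funpow_swap1)
  also have "\<dots> = (updown q q ^^ a) f 0 + q * (updown q q ^^ a) (up (updown q 1 f)) 0"
    by (simp add: updown_up funpow_updown_linear)
  also have "\<dots> = (\<Sum>j<Suc a. q ^ j * (updown q q ^^ (Suc a - Suc j)) ((updown q 1 ^^ j) f) 0)"
    unfolding Suc.IH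
    by (simp add: sum.lessThan_Suc_shift sum_distrib_left funpow_swap1 mult.assoc
        del: sum.lessThan_Suc)
  finally show ?case .
qed

text \<open>Push \<open>down\<close> to the right: each Z either absorbs it or lets it pass and
  becomes an X. In term \<open>j\<close> it has passed \<open>j\<close> of them.\<close>

lemma down_funpow_updown:
  "down q ((updown q 1 ^^ a) f) h = (updown q q ^^ a) (down q f) h +
     (\<Sum>j<a. (updown q q ^^ j) ((updown q 1 ^^ (a - Suc j)) f) h)"
proof (induction a arbitrary: f)
  case 0
  show ?case by simp
next
  case (Suc a)
  have "down q ((updown q 1 ^^ Suc a) f) h = down q ((updown q 1 ^^ a) (updown q 1 f)) h"
    by (simp add: funpow_swap1)
  also have "\<dots> = (updown q q ^^ a) (updown q q (down q f)) h + (updown q q ^^ a) f h +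
     (\<Sum>j<a. (updown q q ^^ j) ((updown q 1 ^^ (a - Suc j)) (updown q 1 f)) h)"
    by (simp add: Suc.IH down_updown funpow_updown_add)
  also have "(\<Sum>j<a. (updown q q ^^ j) ((updown q 1 ^^ (a - Suc j)) (updown q 1 f)) h) =
     (\<Sum>j<a. (updown q q ^^ j) ((updown q 1 ^^ (Suc a - Suc j)) f) h)"
  proof (rule sum.cong[OF refl])
    fix j assume "j \<in> {..<a}"
    then have "Suc a - Suc j = Suc (a - Suc j)" by auto
    then show "(updown q q ^^ j) ((updown q 1 ^^ (a - Suc j)) (updown q 1 f)) h =
       (updown q q ^^ j) ((updown q 1 ^^ (Suc a - Suc j)) f) h"
      by (simp only: funpow_Suc_right o_apply)
  qed
  finally show ?case by (simp add: funpow_swap1)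
qed

text \<open>At 0 only the D of the outermost Z survives. Pushed through to \<open>vacuum\<close> it
  gives 0, so only the terms in which it is absorbed remain.\<close>

lemma mixed_0: "mixed q 0 (N + 2) = (\<Sum>c\<le>N. mixed q (N - c) c)"
proof -
  have v: "down q vacuum = (\<lambda>_. 0)" by (simp add: fun_eq_iff down_def vacuum_def)
  have "mixed q 0 (N + 2) = down q ((updown q 1 ^^ Suc N) vacuum) 0"
    by (simp add: mixed_def) (simp add: updown_def up_def)
  also have "\<dots> = (\<Sum>j<Suc N. mixed q j (N - j))"
    unfolding down_funpow_updown by (simp add: v funpow_updown_zero updown_zero mixed_def)
  also have "\<dots> = (\<Sum>c\<le>N. mixed q (N - c) c)"
    unfolding lessThan_Suc_atMost by (rule sum.reindex_bij_witness[where i="\<lambda>j. N - j" and j="\<lambda>j. N - j"]) auto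
  finally show ?thesis .
qed

text \<open>The innermost X is replaced by a Z; the difference \<open>(q - 1)\<close> U is then
  pushed out to the left.\<close>

lemma mixed_Suc:
  "mixed q (Suc a) b = mixed q a (Suc b) + (q - 1) * (\<Sum>j<a. q ^ j * mixed q (a - Suc j) (b + j))"
proof -
  define v where "v = (updown q 1 ^^ b) vacuum"
  have *: "updown q q v = (\<lambda>h. updown q 1 v h + (q - 1) * up v h)"
    by (rule ext) (simp add: updown_def algebra_simps)
  have "mixed q (Suc a) b = (updown q q ^^ a) (updown q q v) 0"
    by (simp add: mixed_def v_def funpow_swap1)
  also have "\<dots> = (updown q q ^^ a) (updown q 1 v) 0 + (q - 1) * (updown q q ^^ a) (up v) 0"
    unfolding * by (simp add: funpow_updown_linear)
  finally show ?thesis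
    by (simp add: funpow_updown_up mixed_def v_def funpow_add add.commute[of b])
qed

text \<open>The truncated exponent will count the north steps between consecutive east steps. Going
  from \<open>Suc b\<close> to \<open>b\<close>, the correction in \<open>mixed_Suc\<close>
  multiplies exactly the terms with \<open>c\<close> \<ge> \<open>b\<close> by \<open>q\<close>,
  because q^(c-b) + (q-1) q^(c-b) = q^(c+1-b).\<close>

lemma mixed_rec:
  "a + b = N + 2 \<Longrightarrow> mixed q a b = (\<Sum>c\<le>N. q ^ (Suc c - b) * mixed q (N - c) c)"
proof (induction a arbitrary: b)
  case 0
  \<comment> \<open>Here \<open>b = N + 2\<close>, so every exponent is truncated to 0.\<close>
  then show ?case by (simp add: mixed_0[of q N, simplified])
next
  case (Suc a)
  have diff_index: "N - (b + j) = a - Suc j" for j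
    using Suc.prems by arith
  have "(\<Sum>j<a. q ^ j * mixed q (a - Suc j) (b + j)) =
     (\<Sum>c\<in>{b..N}. q ^ (c - b) * mixed q (N - c) c)"
    using Suc.prems
    by (intro sum.reindex_bij_witness[where i="\<lambda>c. c - b" and j="\<lambda>j. b + j"])
      (auto simp: diff_index)
  also have "\<dots> = (\<Sum>c\<le>N. if b \<le> c then q ^ (c - b) * mixed q (N - c) c else 0)"
    by (simp add: sum.If_cases) (rule sum.cong, auto)
  finally have *: "(\<Sum>j<a. q ^ j * mixed q (a - Suc j) (b + j)) = \<dots>" .
  have "mixed q (Suc a) b = (\<Sum>c\<le>N. q ^ (Suc c - Suc b) * mixed q (N - c) c) +
      (q - 1) * (\<Sum>c\<le>N. if b \<le> c then q ^ (c - b) * mixed q (N - c) c else 0)"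
    unfolding mixed_Suc * using Suc.IH[of "Suc b"] Suc.prems by simp
  also have "\<dots> = (\<Sum>c\<le>N. q ^ (Suc c - b) * mixed q (N - c) c)"
    unfolding sum_distrib_left sum.distrib[symmetric]
    by (rule sum.cong) (auto simp: Suc_diff_le algebra_simps)
  finally show ?case .
qed

subsection \<open>Paths as height sequences\<close>

definition climb :: "int \<Rightarrow> step list" where
  "climb d = replicate (nat d) North @ replicate (nat (- d)) South"

fun path_word :: "int \<Rightarrow> int list \<Rightarrow> int \<Rightarrow> step list" where
  "path_word y [] e = climb (e - y)"
| "path_word y (a # as) e = climb (a - y) @ East # path_word a as e"

fun heights_of :: "int \<Rightarrow> step list \<Rightarrow> int list" where
  "heights_of y [] = []"
| "heights_of y (East # w) = y # heights_of y w"
| "heights_of y (North # w) = heights_of (y + 1) w"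
| "heights_of y (South # w) = heights_of (y - 1) w"

fun ascent :: "int \<Rightarrow> int list \<Rightarrow> int \<Rightarrow> nat" where
  "ascent y [] e = nat (e - y)"
| "ascent y (a # as) e = nat (a - y) + ascent a as e"

fun heights :: "int \<Rightarrow> nat \<Rightarrow> int list set" where
  "heights x 0 = {[]}"
| "heights x (Suc n) = (\<lambda>(a, as). a # as) ` ({- x..x} \<times> heights (x + 1) n)"

lemma climb_0 [simp]: "climb 0 = []"
  by (simp add: climb_def)

lemma climb_North: "d > 0 \<Longrightarrow> climb d = North # climb (d - 1)"
  by (auto simp: climb_def nat_diff_distrib Suc_nat_eq_nat_zadd1 simp flip: replicate_Suc)

lemma climb_South: "d < 0 \<Longrightarrow> climb d = South # climb (d + 1)"
  by (auto simp: climb_def nat_diff_distrib Suc_nat_eq_nat_zadd1 simp flip: replicate_Suc)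

section \<open>Vertices of path words: self-avoidance and the wedge\<close>

lemma in_vertices_from: "p \<in> set (vertices_from p w)"
  by (cases w) auto

lemma vertices_from_nonempty [simp]: "vertices_from p w \<noteq> []"
  by (cases w) auto

lemma fst_vertices_from: "v \<in> set (vertices_from p w) \<Longrightarrow> fst p \<le> fst v"
proof (induction p w rule: vertices_from.induct)
  case (2 p s w)
  then show ?case by (cases s) auto
qed auto

lemma vertices_from_replicate:
  "vertices_from (x, y) (replicate k North @ w) =
     map (\<lambda>i. (x, y + int i)) [0..<k] @ vertices_from (x, y + int k) w"
  "vertices_from (x, y) (replicate k South @ w) =
     map (\<lambda>i. (x, y - int i)) [0..<k] @ vertices_from (x, y - int k) w"
  by (induction k arbitrary: y)
    (simp_all add: upt_conv_Cons map_Suc_upt[symmetric] comp_def algebra_simps del: upt_Suc)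

text \<open>The end of the climb is left out of the listed column, being the first vertex of the
  rest.\<close>

lemma vertices_from_climb:
  "vertices_from (x, y) (climb d @ w) =
     map (\<lambda>i. (x, y + sgn d * int i)) [0..<nat \<bar>d\<bar>] @ vertices_from (x, y + d) w"
  using vertices_from_replicate(1)[of x y "nat d" w] vertices_from_replicate(2)[of x y "nat (- d)" w]
  by (cases "d \<ge> 0") (auto simp: climb_def sgn_if)

lemma vertices_from_climb_end:
  "vertices_from (x, y) (climb d) =
     map (\<lambda>i. (x, y + sgn d * int i)) [0..<nat \<bar>d\<bar>] @ [(x, y + d)]"
  using vertices_from_climb[of x y d "[]"] by simp

lemma last_path_word:
  "last (vertices_from (x, y) (path_word y as e)) = (x + int (length as), e)"
  by (induction as arbitrary: x y) (simp_all add: vertices_from_climb vertices_from_climb_end)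

lemma distinct_column:
  "distinct (map (\<lambda>i. (x :: int, y + sgn d * int i)) [0..<nat \<bar>d\<bar>] @ [(x, y + d)])"
  by (auto simp: distinct_map inj_on_def sgn_if split: if_splits)

text \<open>Each column is traversed monotonically, and everything after an east step lies strictly
  to the right.\<close>

lemma distinct_path_word: "distinct (vertices_from (x, y) (path_word y as e))"
proof (induction as arbitrary: x y)
  case Nil
  show ?case using distinct_column[of x y "e - y"] by (simp add: vertices_from_climb_end)
next
  case (Cons a as)
  show ?case
    using Cons.IH[of "x + 1" a] distinct_column[of x y "a - y"]
    by (auto simp: vertices_from_climb dest: fst_vertices_from)
qed

text \<open>A column of the wedge is an interval, so only the two ends of a climb matter.\<close>

lemma climb_in_wedge:
  "set (vertices_from (x, y) (climb d @ w)) \<subseteq> wedge \<longleftrightarrow>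
     \<bar>y\<bar> \<le> x \<and> set (vertices_from (x, y + d) w) \<subseteq> wedge"
proof -
  have "(x, y + sgn d * int i) \<in> wedge"
    if "\<bar>y\<bar> \<le> x" "(x, y + d) \<in> wedge" "i < nat \<bar>d\<bar>" for i
    using that by (auto simp: wedge_def sgn_if split: if_splits)
  moreover have "\<bar>y\<bar> \<le> x" if "set (vertices_from (x, y) (climb d @ w)) \<subseteq> wedge"
    using subsetD[OF that in_vertices_from] by (auto simp: wedge_def)
  ultimately show ?thesis
    using in_vertices_from[of "(x, y + d)" w] by (auto simp: vertices_from_climb)
qed

lemma length_heights: "as \<in> heights x n \<Longrightarrow> length as = n"
  by (induction n arbitrary: x as) auto

lemma path_word_in_wedge:
  "set (vertices_from (x, y) (path_word y as e)) \<subseteq> wedge \<longleftrightarrow>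
     \<bar>y\<bar> \<le> x \<and> \<bar>e\<bar> \<le> x + int (length as) \<and> as \<in> heights x (length as)"
proof (induction as arbitrary: x y)
  case Nil
  show ?case using climb_in_wedge[of x y "e - y" "[]"] by (auto simp: wedge_def)
next
  case (Cons a as)
  have "set (vertices_from (x, y) (path_word y (a # as) e)) \<subseteq> wedge \<longleftrightarrow>
      \<bar>y\<bar> \<le> x \<and> \<bar>a\<bar> \<le> x \<and> set (vertices_from (x + 1, a) (path_word a as e)) \<subseteq> wedge"
    using in_vertices_from[of "(x + 1, a)" "path_word a as e"]
    by (auto simp: climb_in_wedge) (auto simp: wedge_def)
  then show ?case unfolding Cons.IH by (auto simp: image_iff)
qed

section \<open>Recovering a path from its heights\<close>

lemma heights_of_climb: "heights_of y (climb d @ w) = heights_of (y + d) w"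
proof (induction "nat \<bar>d\<bar>" arbitrary: d y)
  case (Suc k)
  show ?case
  proof (cases "d > 0")
    case True
    with Suc show ?thesis by (simp add: climb_North)
  next
    case False
    with Suc.hyps(2) have "d < 0" and "k = nat \<bar>d + 1\<bar>" by auto
    with Suc.hyps(1)[of "d + 1" "y - 1"] show ?thesis by (simp add: climb_South)
  qed
qed simp

lemma heights_of_path_word: "heights_of y (path_word y as e) = as"
proof (induction as arbitrary: y)
  case Nil
  show ?case using heights_of_climb[of y "e - y" "[]"] by simp
qed (simp add: heights_of_climb)

text \<open>Confines the dependence on the starting height to the first climb, so that a vertical
  step can be put in front of it.\<close>

lemma path_word_shift: "\<exists>t r. \<forall>y. path_word y as e = climb (t - y) @ r"
proof (cases as)
  case Nil
  then show ?thesis by (auto intro!: exI[of _ e] exI[of _ "[]"])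
next
  case (Cons a as')
  then show ?thesis by (auto intro!: exI[of _ a] exI[of _ "East # path_word a as' e"])
qed

text \<open>Self-avoidance makes every vertical run monotone, so the heights of the east steps and
  the final height determine the word.\<close>

lemma path_word_heights_of:
  "distinct (vertices_from (x, y) w) \<Longrightarrow>
     path_word y (heights_of y w) (snd (last (vertices_from (x, y) w))) = w"
proof (induction w arbitrary: x y)
  case (Cons s w)
  show ?case
  proof (cases s)
    case East
    with Cons show ?thesis by simp
  next
    case North
    define e where "e = snd (last (vertices_from (x, y + 1) w))"
    obtain t r where tr: "\<And>z. path_word z (heights_of (y + 1) w) e = climb (t - z) @ r"
      using path_word_shift by blast
    have w: "w = climb (t - (y + 1)) @ r"
      using Cons.IH[of x "y + 1"] Cons.prems North by (simp add: tr e_def[symmetric])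
    \<comment> \<open>A South right after the North would lead straight back to
      \<open>(x, y)\<close>.\<close>
    have "\<not> t - (y + 1) < 0"
    proof
      assume "t - (y + 1) < 0"
      from climb_South[OF this] w obtain w' where "w = South # w'" by auto
      with Cons.prems North show False
        using in_vertices_from[of "(x, y)" w'] by simp
    qed
    then have "climb (t - y) @ r = North # w"
      using climb_North[of "t - y"] by (subst w) (simp add: algebra_simps)
    with North show ?thesis by (simp add: tr e_def[symmetric])
  next
    case South
    define e where "e = snd (last (vertices_from (x, y - 1) w))"
    obtain t r where tr: "\<And>z. path_word z (heights_of (y - 1) w) e = climb (t - z) @ r"
      using path_word_shift by blast
    have w: "w = climb (t - (y - 1)) @ r"
      using Cons.IH[of x "y - 1"] Cons.prems South by (simp add: tr e_def[symmetric])
    have "\<not> t - (y - 1) > 0"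
    proof
      assume "t - (y - 1) > 0"
      from climb_North[OF this] w obtain w' where "w = North # w'" by auto
      with Cons.prems South show False
        using in_vertices_from[of "(x, y)" w'] by simp
    qed
    then have "climb (t - y) @ r = South # w"
      using climb_South[of "t - y"] by (subst w) (simp add: algebra_simps)
    with South show ?thesis by (simp add: tr e_def[symmetric])
  qed
qed simp

lemma count_list_replicate: "count_list (replicate n a) b = (if a = b then n else 0)"
  by (induction n) auto

lemma count_East_path_word: "count_list (path_word y as e) East = length as"
  by (induction as arbitrary: y) (simp_all add: climb_def count_list_replicate)

lemma north_steps_path_word: "north_steps (path_word y as e) = ascent y as e"
  by (induction as arbitrary: y) (simp_all add: north_steps_def climb_def count_list_replicate)

lemma wedge_paths_eq: "wedge_paths n = (\<lambda>as. path_word 0 as (- int n)) ` heights 0 n"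
proof (intro equalityI subsetI)
  fix w assume "w \<in> wedge_paths n"
  then have w: "distinct (vertices_from (0, 0) w)" "set (vertices_from (0, 0) w) \<subseteq> wedge"
      "count_list w East = n" "last (vertices_from (0, 0) w) = (int n, - int n)"
    by (auto simp: wedge_paths_def partially_directed_path_def vertices_def)
  define as where "as = heights_of 0 w"
  have word: "w = path_word 0 as (- int n)"
    using path_word_heights_of[OF w(1)] w(4) by (simp add: as_def)
  with w(3) have "length as = n" by (simp add: count_East_path_word)
  with w(2) word have "as \<in> heights 0 n" by (simp add: path_word_in_wedge)
  with word show "w \<in> (\<lambda>as. path_word 0 as (- int n)) ` heights 0 n" by blast
next
  fix w assume "w \<in> (\<lambda>as. path_word 0 as (- int n)) ` heights 0 n"
  then obtain as where w: "w = path_word 0 as (- int n)" and as: "as \<in> heights 0 n" by blast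
  have "set (vertices_from (0, 0) w) \<subseteq> wedge"
    unfolding w path_word_in_wedge using as by (simp add: length_heights)
  then show "w \<in> wedge_paths n"
    using as by (simp add: w wedge_paths_def partially_directed_path_def vertices_def
        distinct_path_word count_East_path_word last_path_word length_heights)
qed

section \<open>Generating function of the paths by north steps\<close>

lemma finite_heights: "finite (heights x n)"
  by (induction n arbitrary: x) auto

lemma sum_heights_Suc:
  "(\<Sum>as\<in>heights x (Suc n). f as) = (\<Sum>a\<in>{- x..x}. \<Sum>as\<in>heights (x + 1) n. f (a # as))"
proof -
  have "inj_on (\<lambda>(a, as). a # as) ({- x..x} \<times> heights (x + 1) n)"
    by (auto simp: inj_on_def)
  then show ?thesis by (simp add: sum.reindex sum.cartesian_product) (rule sum.cong, auto)
qed

text \<open>Here \<open>mixed q (2 * k - c) c\<close> plays the total weight of the initial pieces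
  whose east step number \<open>k + 1\<close> has height \<open>k - c\<close>. Reading one more
  column regroups the sum by \<open>mixed_rec\<close>, so its value does not depend on where the
  paths are cut.\<close>

lemma sum_ascent_from:
  "(\<Sum>c\<le>2 * k. mixed q (2 * k - c) c *
      (\<Sum>as\<in>heights (int k + 1) n. q ^ ascent (int k - int c) as (- int (Suc k + n)))) =
   mixed q 0 (2 * (Suc k + n))"
proof (induction n arbitrary: k)
  case 0
  \<comment> \<open>The last climb starts at \<open>k - c\<close>, which is at least
    \<open>- k\<close>, and ends at \<open>- (k + 1)\<close>: it has no north steps.\<close>
  have "(\<Sum>c\<le>2 * k. mixed q (2 * k - c) c *
      (\<Sum>as\<in>heights (int k + 1) 0. q ^ ascent (int k - int c) as (- int (Suc k + 0)))) =
     (\<Sum>c\<le>2 * k. mixed q (2 * k - c) c)"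
    by (rule sum.cong) auto
  then show ?case using mixed_0[of q "2 * k"] by simp
next
  case (Suc n)
  define F where "F a = (\<Sum>as\<in>heights (int (Suc k) + 1) n. q ^ ascent a as (- int (Suc (Suc k) + n)))"
    for a
  \<comment> \<open>The next east step has height \<open>k + 1 - c'\<close>, so the rise to it from
    \<open>k - c\<close> is \<open>c + 1 - c'\<close>.\<close>
  have split: "(\<Sum>as\<in>heights (int k + 1) (Suc n). q ^ ascent (int k - int c) as (- int (Suc k + Suc n))) =
      (\<Sum>c'\<le>2 * Suc k. q ^ (Suc c - c') * F (int (Suc k) - int c'))" for c
  proof -
    have "(\<Sum>as\<in>heights (int k + 1) (Suc n). q ^ ascent (int k - int c) as (- int (Suc k + Suc n))) =
       (\<Sum>a\<in>{- (int k + 1)..int k + 1}. q ^ nat (a - (int k - int c)) * F a)"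
      unfolding sum_heights_Suc
      by (simp add: F_def power_add sum_distrib_left add_ac)
    also have "\<dots> = (\<Sum>c'\<le>2 * Suc k. q ^ (Suc c - c') * F (int (Suc k) - int c'))"
      by (rule sum.reindex_bij_witness
          [where i="\<lambda>c'. int (Suc k) - int c'" and j="\<lambda>a. nat (int (Suc k) - a)"])
        (auto intro!: arg_cong[where f="\<lambda>i. q ^ i * _"])
    finally show ?thesis .
  qed
  have "(\<Sum>c\<le>2 * k. mixed q (2 * k - c) c *
      (\<Sum>as\<in>heights (int k + 1) (Suc n). q ^ ascent (int k - int c) as (- int (Suc k + Suc n)))) =
    (\<Sum>c'\<le>2 * Suc k. (\<Sum>c\<le>2 * k. q ^ (Suc c - c') * mixed q (2 * k - c) c) * F (int (Suc k) - int c'))"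
    unfolding split sum_distrib_left sum_distrib_right
    by (subst sum.swap) (simp add: mult_ac)
  also have "\<dots> = (\<Sum>c'\<le>2 * Suc k. mixed q (2 * Suc k - c') c' * F (int (Suc k) - int c'))"
    by (intro sum.cong refl arg_cong2[where f="(*)"] mixed_rec[symmetric]) auto
  also have "\<dots> = mixed q 0 (2 * (Suc (Suc k) + n))"
    unfolding F_def by (rule Suc.IH)
  finally show ?case by simp
qed

lemma sum_north_steps:
  assumes "n \<ge> 1"
  shows "(\<Sum>P\<in>wedge_paths n. q ^ north_steps P) = mixed q 0 (2 * n)"
proof -
  obtain m where n: "n = Suc m" using assms by (cases n) auto
  have "inj_on (\<lambda>as. path_word 0 as (- int n)) (heights 0 n)"
    by (rule inj_on_inverseI) (rule heights_of_path_word)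
  then have "(\<Sum>P\<in>wedge_paths n. q ^ north_steps P) = (\<Sum>as\<in>heights 0 n. q ^ ascent 0 as (- int n))"
    by (simp add: wedge_paths_eq sum.reindex north_steps_path_word)
  \<comment> \<open>The first east step must have height 0. This is the case \<open>k = 0\<close>
    above, whose only initial weight is \<open>mixed q 0 0 = 1\<close>.\<close>
  also have "\<dots> = (\<Sum>as\<in>heights 1 m. q ^ ascent 0 as (- int n))"
    unfolding n sum_heights_Suc by simp
  also have "\<dots> = mixed q 0 (2 * n)"
    using sum_ascent_from[where k=0 and q=q and n=m] by (simp add: n mixed_def vacuum_def)
  finally show ?thesis .
qed

subsection \<open>Partial matchings\<close>

text \<open>The singleton blocks of a partial matching are its unmatched (open) vertices.\<close>

definition pmatchings :: "nat set \<Rightarrow> nat set set set" where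
  "pmatchings A = {M. partition_on A M \<and> (\<forall>e\<in>M. card e = 1 \<or> card e = 2)}"

definition unmatched :: "nat set set \<Rightarrow> nat set" where
  "unmatched M = {s. {s} \<in> M}"

definition edges :: "nat set set \<Rightarrow> (nat \<times> nat) set" where
  "edges M = {(a, b). a < b \<and> {a, b} \<in> M}"

definition nested_edges :: "(nat \<times> nat) set \<Rightarrow> nat" where
  "nested_edges E = (\<Sum>e\<in>E. card {f \<in> E. fst e < fst f \<and> snd f < snd e})"

text \<open>An open vertex counts as the left end of an edge reaching beyond all other points.\<close>

definition nestings :: "nat set set \<Rightarrow> nat" where
  "nestings M = nested_edges (edges M) + (\<Sum>s\<in>unmatched M. card {f \<in> edges M. s < fst f})"

lemma finite_pmatchings: "finite A \<Longrightarrow> finite (pmatchings A)"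
  by (rule finite_subset[OF _ finitely_many_partition_on]) (auto simp: pmatchings_def)

text \<open>Serves both to add and to delete a block; \<open>e \<notin> N\<close> excludes an
  insertion that changes nothing.\<close>

lemma pmatchings_insert:
  assumes "e \<inter> A = {}" "card e = 1 \<or> card e = 2"
  shows "insert e N \<in> pmatchings (A \<union> e) \<and> e \<notin> N \<longleftrightarrow> N \<in> pmatchings A"
proof -
  have e: "e \<noteq> {}" using assms(2) by auto
  have [simp]: "A \<union> e - e = A" using assms(1) by auto
  have "partition_on (A \<union> e) (insert e N) \<and> e \<notin> N \<longleftrightarrow> partition_on A N"
  proof (cases "disjnt e (\<Union>N)")
    case True
    then have "e \<notin> N" using e by (auto simp: disjnt_def)
    with True e show ?thesis by (simp add: partition_on_insert)
  next
    case False
    have "\<not> partition_on A N"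
      using False assms(1) by (auto simp: partition_on_def disjnt_def)
    moreover have "\<not> (partition_on (A \<union> e) (insert e N) \<and> e \<notin> N)"
    proof
      assume *: "partition_on (A \<union> e) (insert e N) \<and> e \<notin> N"
      from False obtain f where "f \<in> N" "e \<inter> f \<noteq> {}" by (auto simp: disjnt_def)
      with * show False by (auto simp: partition_on_def dest!: disjointD[of _ e f])
    qed
    ultimately show ?thesis by blast
  qed
  with assms(2) show ?thesis by (auto simp: pmatchings_def)
qed

lemma pmatchings_subset: "M \<in> pmatchings A \<Longrightarrow> e \<in> M \<Longrightarrow> e \<subseteq> A"
  by (auto simp: pmatchings_def partition_on_def)

lemma unmatched_subset: "M \<in> pmatchings A \<Longrightarrow> unmatched M \<subseteq> A"
  by (auto simp: unmatched_def dest: pmatchings_subset)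

lemma edges_subset: "M \<in> pmatchings A \<Longrightarrow> edges M \<subseteq> A \<times> A"
  by (auto simp: edges_def dest: pmatchings_subset)

lemma unmatched_insert [simp]:
  "unmatched (insert {a} N) = insert a (unmatched N)"
  "a \<noteq> b \<Longrightarrow> unmatched (insert {a, b} N) = unmatched N"
  by (auto simp: unmatched_def)

lemma edges_insert [simp]:
  "edges (insert {a} N) = edges N"
  "a < b \<Longrightarrow> edges (insert {a, b} N) = insert (a, b) (edges N)"
  by (auto simp: edges_def doubleton_eq_iff)

text \<open>The new vertex lies to the right of all edges, so as a left end it nests none of
  them.\<close>

lemma nestings_open:
  assumes N: "N \<in> pmatchings {1..m}"
  shows "nestings (insert {Suc m} N) = nestings N"
proof -
  have fin: "finite (unmatched N)"
    using unmatched_subset[OF N] finite_subset by blast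
  have "Suc m \<notin> unmatched N" using unmatched_subset[OF N] by auto
  moreover have "{f \<in> edges N. Suc m < fst f} = {}" using edges_subset[OF N] by auto
  then have "card {f \<in> edges N. Suc m < fst f} = 0" by (simp only: card.empty)
  ultimately show ?thesis using fin by (simp add: nestings_def)
qed

text \<open>Closing an open vertex turns the edges to its right into nested ones, but the open vertices
  to its left now each wait to nest the new edge.\<close>

lemma nestings_close:
  assumes N: "N \<in> pmatchings ({1..m} - {s})" and s: "s \<in> {1..m}"
  shows "nestings (insert {s, Suc m} N) =
    nestings (insert {s} N) + card {t \<in> unmatched N. t < s}"
proof -
  define E where "E = edges N"
  define S where "S = unmatched N"
  have S: "S \<subseteq> {1..m} - {s}" using unmatched_subset[OF N] by (simp add: S_def)
  then have finS: "finite S" by (rule finite_subset) simp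
  have E: "E \<subseteq> ({1..m} - {s}) \<times> ({1..m} - {s})" using edges_subset[OF N] by (simp add: E_def)
  then have finE: "finite E" by (rule finite_subset) simp
  have new: "(s, Suc m) \<notin> E" using E by auto
  have "{f \<in> insert (s, Suc m) E. s < fst f \<and> snd f < Suc m} = {f \<in> E. s < fst f}"
    using E by auto
  moreover have "{f \<in> insert (s, Suc m) E. fst e < fst f \<and> snd f < snd e} =
      {f \<in> E. fst e < fst f \<and> snd f < snd e}" if "e \<in> E" for e
    using E that by auto
  ultimately have "nested_edges (insert (s, Suc m) E) = card {f \<in> E. s < fst f} + nested_edges E"
    unfolding nested_edges_def using finE new by (simp cong: sum.cong)
  moreover have "(\<Sum>t\<in>S. card {f \<in> insert (s, Suc m) E. t < fst f}) =
      (\<Sum>t\<in>S. card {f \<in> E. t < fst f}) + card {t \<in> S. t < s}"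
  proof -
    have "card {f \<in> insert (s, Suc m) E. t < fst f} =
        card {f \<in> E. t < fst f} + (if t < s then 1 else 0)" for t
    proof (cases "t < s")
      case True
      then have "{f \<in> insert (s, Suc m) E. t < fst f} = insert (s, Suc m) {f \<in> E. t < fst f}"
        by auto
      with True finE new show ?thesis by simp
    next
      case False
      then have "{f \<in> insert (s, Suc m) E. t < fst f} = {f \<in> E. t < fst f}" by auto
      with False show ?thesis by simp
    qed
    then show ?thesis using finS by (simp add: sum.distrib sum.If_cases Int_def)
  qed
  moreover have "s \<notin> S" using S by auto
  ultimately show ?thesis
    using s finS by (simp add: nestings_def flip: E_def S_def)
qed

text \<open>The ranks of the elements of \<open>S\<close> are 0, ..., \<open>card S - 1\<close>. For
  the open vertices that may be closed, this gives the weight in \<open>down\<close>.\<close>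

lemma sum_rank:
  fixes q :: "'a::comm_ring_1"
  assumes "finite (S :: nat set)"
  shows "(\<Sum>s\<in>S. q ^ card {t \<in> S. t < s}) = (\<Sum>i<card S. q ^ i)"
  using assms
proof (induction S rule: finite_linorder_max_induct)
  case empty
  show ?case by simp
next
  case (insert b S)
  have "{t \<in> insert b S. t < s} = {t \<in> S. t < s}" if "s \<in> S" for s
    using insert.hyps that by auto
  moreover have "{t \<in> insert b S. t < b} = S" using insert.hyps by auto
  moreover have "b \<notin> S" using insert.hyps by auto
  ultimately show ?case using insert by (simp add: add.commute cong: sum.cong)
qed

section \<open>Generating function of the partial matchings by nestings\<close>

definition pmatchings_with :: "nat \<Rightarrow> nat \<Rightarrow> nat set set set" where
  "pmatchings_with m h = {M \<in> pmatchings {1..m}. card (unmatched M) = h}"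

lemma finite_pmatchings_with: "finite (pmatchings_with m h)"
  by (rule finite_subset[OF _ finite_pmatchings[of "{1..m}"]]) (auto simp: pmatchings_with_def)

text \<open>The last point is open or joined to some \<open>s\<close>, and deleting it in the second
  case leaves \<open>s\<close> open. The form \<open>Suc (card (unmatched N)) = h\<close> makes the
  first set empty for \<open>h = 0\<close>.\<close>

lemma pmatchings_with_Suc:
  "pmatchings_with (Suc m) h =
     (\<lambda>N. insert {Suc m} N) ` {N \<in> pmatchings {1..m}. Suc (card (unmatched N)) = h} \<union>
     (\<lambda>(M, s). insert {s, Suc m} (M - {{s}})) ` (SIGMA M:pmatchings_with m (Suc h). unmatched M)"
    (is "?L = ?A \<union> ?B")
proof (intro equalityI subsetI)
  fix M assume M: "M \<in> ?L"
  then have pm: "M \<in> pmatchings {1..Suc m}" and card: "card (unmatched M) = h"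
    by (auto simp: pmatchings_with_def)
  then have "Suc m \<in> \<Union>M" by (simp add: pmatchings_def partition_on_def)
  then obtain e where e: "e \<in> M" "Suc m \<in> e" by blast
  have sub: "e \<subseteq> {1..Suc m}" using pmatchings_subset[OF pm e(1)] .
  have ins: "insert e (M - {e}) = M" using e(1) by auto
  have un: "{1..Suc m} - e \<union> e = {1..Suc m}" using sub by auto
  from pm e have ce: "card e = 1 \<or> card e = 2" by (auto simp: pmatchings_def)
  have N: "M - {e} \<in> pmatchings ({1..Suc m} - e)"
    using pmatchings_insert[of e "{1..Suc m} - e" "M - {e}"] pm ce unfolding ins un by blast
  from ce show "M \<in> ?A \<union> ?B"
  proof
    assume "card e = 1"
    with e have e': "e = {Suc m}" by (auto simp: card_1_singleton_iff)
    have rest: "{1..Suc m} - e = {1..m}" by (auto simp: e')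
    define N where "N = M - {e}"
    have N': "N \<in> pmatchings {1..m}" using N rest by (simp add: N_def)
    have "M = insert {Suc m} N" using ins e' by (simp add: N_def)
    moreover have "Suc m \<notin> unmatched N" "finite (unmatched N)"
      using unmatched_subset[OF N'] finite_subset[of "unmatched N" "{1..m}"] by auto
    ultimately show ?thesis using N' card by auto
  next
    assume "card e = 2"
    then obtain s where e': "e = {s, Suc m}" "s \<noteq> Suc m"
      using e(2) by (auto simp: card_2_iff)
    with sub have s: "s \<in> {1..m}" by auto
    have rest: "{1..Suc m} - e = {1..m} - {s}" by (auto simp: e')
    define N where "N = M - {e}"
    have N': "N \<in> pmatchings ({1..m} - {s})" using N rest by (simp add: N_def)
    have M: "M = insert {s, Suc m} N" using ins e' by (simp add: N_def)
    have "{1..m} - {s} \<union> {s} = {1..m}" using s by auto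
    then have K: "insert {s} N \<in> pmatchings {1..m}" "{s} \<notin> N"
      using pmatchings_insert[of "{s}" "{1..m} - {s}" N] N' by auto
    have "s \<notin> unmatched N" "finite (unmatched N)"
      using unmatched_subset[OF N'] finite_subset[of "unmatched N" "{1..m}"] by auto
    moreover have "card (unmatched N) = h" using card e'(2) by (simp add: M)
    ultimately have "insert {s} N \<in> pmatchings_with m (Suc h)"
      using K by (simp add: pmatchings_with_def)
    then have "(insert {s} N, s) \<in> (SIGMA M:pmatchings_with m (Suc h). unmatched M)" by simp
    moreover have "M = (\<lambda>(M, s). insert {s, Suc m} (M - {{s}})) (insert {s} N, s)"
      using K(2) by (simp add: M)
    ultimately show ?thesis by blast
  qed
next
  fix M assume "M \<in> ?A \<union> ?B"
  then show "M \<in> ?L"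
  proof
    assume "M \<in> ?A"
    then obtain N where N: "N \<in> pmatchings {1..m}" "Suc (card (unmatched N)) = h"
      and M: "M = insert {Suc m} N" by auto
    have "{1..m} \<union> {Suc m} = {1..Suc m}" by auto
    then have "M \<in> pmatchings {1..Suc m}"
      using pmatchings_insert[of "{Suc m}" "{1..m}" N] N(1) M by auto
    moreover have "Suc m \<notin> unmatched N" "finite (unmatched N)"
      using unmatched_subset[OF N(1)] finite_subset[of "unmatched N" "{1..m}"] by auto
    ultimately show ?thesis using N(2) by (simp add: pmatchings_with_def M)
  next
    assume "M \<in> ?B"
    then obtain K s where K: "K \<in> pmatchings {1..m}" "card (unmatched K) = Suc h"
      and s: "{s} \<in> K" and M: "M = insert {s, Suc m} (K - {{s}})"
      by (auto simp: pmatchings_with_def unmatched_def)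
    define N where "N = K - {{s}}"
    have KN: "K = insert {s} N" using s by (auto simp: N_def)
    have sm: "s \<in> {1..m}" using pmatchings_subset[OF K(1) s] by auto
    have "{1..m} - {s} \<union> {s} = {1..m}" using sm by auto
    then have N: "N \<in> pmatchings ({1..m} - {s})"
      using pmatchings_insert[of "{s}" "{1..m} - {s}" N] K(1) unfolding KN[symmetric]
      by (simp add: N_def)
    have "{1..m} - {s} \<union> {s, Suc m} = {1..Suc m}" using sm by auto
    moreover have "card {s, Suc m} = 2" using sm by auto
    ultimately have "M \<in> pmatchings {1..Suc m}"
      using pmatchings_insert[of "{s, Suc m}" "{1..m} - {s}" N] N M sm by (auto simp: N_def)
    moreover have "s \<notin> unmatched N" "finite (unmatched N)"
      using unmatched_subset[OF N] finite_subset[of "unmatched N" "{1..m}"] by auto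
    then have "card (unmatched N) = h" using K(2) by (simp add: KN)
    then have "card (unmatched M) = h" using sm M by (simp flip: N_def)
    ultimately show ?thesis by (simp add: pmatchings_with_def)
  qed
qed

text \<open>Adding a last point is one application of Z: leaving it open gives \<open>up\<close>,
  and closing \<open>s\<close> contributes \<open>q\<close> to the rank of \<open>s\<close> among
  the open vertices, which sums to \<open>down\<close>.\<close>

lemma sum_nestings:
  fixes q :: "'a::comm_ring_1"
  shows "(\<Sum>M\<in>pmatchings_with m h. q ^ nestings M) = (updown q 1 ^^ m) vacuum h"
proof (induction m arbitrary: h)
  case 0
  have "pmatchings_with 0 h = (if h = 0 then {{}} else {})"
    by (auto simp: pmatchings_with_def pmatchings_def partition_on_empty unmatched_def)
  then show ?case by (simp add: vacuum_def nestings_def nested_edges_def edges_def unmatched_def)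
next
  case (Suc m)
  define A where "A = {N \<in> pmatchings {1..m}. Suc (card (unmatched N)) = h}"
  define B where "B = (SIGMA M:pmatchings_with m (Suc h). unmatched M)"
  define f where "f = (\<lambda>N. insert {Suc m} N)"
  define g where "g = (\<lambda>(M, s). insert {s, Suc m} (M - {{s}}))"
  have notin: "e \<notin> N" if "N \<in> pmatchings {1..m}" "Suc m \<in> e" for N e
    using subsetD[OF pmatchings_subset[OF that(1)] that(2)] by auto
  have fin_un: "finite (unmatched M)" if "M \<in> pmatchings {1..m}" for M
    using unmatched_subset[OF that] finite_subset by blast
  have finA: "finite A"
    by (rule finite_subset[OF _ finite_pmatchings[of "{1..m}"]]) (auto simp: A_def)
  have finB: "finite B"
    unfolding B_def using fin_un by (intro finite_SigmaI finite_pmatchings_with) (auto simp: pmatchings_with_def)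
  have injf: "inj_on f A"
    using notin by (auto simp: inj_on_def f_def A_def insert_ident)
  have B: "M \<in> pmatchings {1..m} \<and> {s} \<in> M \<and> s \<in> {1..m}" if "(M, s) \<in> B" for M s
    using that pmatchings_subset[of M "{1..m}" "{s}"]
    by (auto simp: B_def pmatchings_with_def unmatched_def)
  have injg: "inj_on g B"
  proof (rule inj_onI, clarify)
    fix M s M' s' assume *: "(M, s) \<in> B" "(M', s') \<in> B" "g (M, s) = g (M', s')"
    then have eq: "insert {s, Suc m} (M - {{s}}) = insert {s', Suc m} (M' - {{s'}})"
      by (simp add: g_def)
    \<comment> \<open>No old block contains \<open>Suc m\<close>, so the new edge can be recognised
      in the image and reveals \<open>s\<close>.\<close>
    have n: "{t, Suc m} \<notin> M" "{t, Suc m} \<notin> M'" for t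
      using B[OF *(1)] B[OF *(2)] notin by auto
    have "{s, Suc m} \<in> insert {s', Suc m} (M' - {{s'}})"
      by (simp only: eq[symmetric] insertI1)
    with n have "{s, Suc m} = {s', Suc m}" by simp
    then have ss: "s = s'" using B[OF *(1)] B[OF *(2)] by (auto simp: doubleton_eq_iff)
    have "M - {{s}} = M' - {{s'}}" using eq n ss by (simp add: insert_ident)
    with ss B[OF *(1)] B[OF *(2)] show "M = M' \<and> s = s'" by blast
  qed
  \<comment> \<open>The two images differ in whether \<open>Suc m\<close> is open.\<close>
  have disj: "f ` A \<inter> g ` B = {}"
  proof (intro equalityI subsetI)
    fix x assume "x \<in> f ` A \<inter> g ` B"
    then obtain N M s where "(M, s) \<in> B" "insert {Suc m} N = insert {s, Suc m} (M - {{s}})"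
      by (auto simp: f_def g_def)
    then have "(M, s) \<in> B" "{Suc m} \<in> insert {s, Suc m} (M - {{s}})"
      by (simp, metis insertI1)
    with B[of M s] notin[of M "{Suc m}"] have "{Suc m} = {s, Suc m}" "s \<in> {1..m}" by auto
    then show "x \<in> {}" by auto
  qed simp
  have "(\<Sum>M\<in>pmatchings_with (Suc m) h. q ^ nestings M) =
      (\<Sum>N\<in>A. q ^ nestings (f N)) + (\<Sum>x\<in>B. q ^ nestings (g x))"
    unfolding pmatchings_with_Suc A_def[symmetric] B_def[symmetric] f_def[symmetric] g_def[symmetric]
    using finA finB disj injf injg by (simp add: sum.union_disjoint sum.reindex)
  moreover have "(\<Sum>N\<in>A. q ^ nestings (f N)) = up ((updown q 1 ^^ m) vacuum) h"
  proof -
    have "(\<Sum>N\<in>A. q ^ nestings (f N)) = (\<Sum>N\<in>A. q ^ nestings N)"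
      by (rule sum.cong) (auto simp: A_def f_def nestings_open)
    moreover have "A = (case h of 0 \<Rightarrow> {} | Suc k \<Rightarrow> pmatchings_with m k)"
      by (auto simp: A_def pmatchings_with_def split: nat.split)
    ultimately show ?thesis by (simp add: up_def Suc.IH split: nat.split)
  qed
  moreover have "(\<Sum>x\<in>B. q ^ nestings (g x)) = down q ((updown q 1 ^^ m) vacuum) h"
  proof -
    have val: "nestings (g (M, s)) = nestings M + card {t \<in> unmatched M. t < s}"
      if "(M, s) \<in> B" for M s
    proof -
      define N where "N = M - {{s}}"
      have M: "M = insert {s} N" using B[OF that] by (auto simp: N_def)
      have "{1..m} - {s} \<union> {s} = {1..m}" using B[OF that] by auto
      then have N: "N \<in> pmatchings ({1..m} - {s})"
        using pmatchings_insert[of "{s}" "{1..m} - {s}" N] B[OF that] unfolding M[symmetric]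
        by (simp add: N_def)
      have "{t \<in> unmatched M. t < s} = {t \<in> unmatched N. t < s}" by (auto simp: M)
      with nestings_close[OF N] B[OF that] show ?thesis by (simp add: g_def flip: M N_def)
    qed
    have "(\<Sum>x\<in>B. q ^ nestings (g x)) =
        (\<Sum>(M, s)\<in>B. q ^ nestings M * q ^ card {t \<in> unmatched M. t < s})"
      by (rule sum.cong) (auto simp: val power_add)
    also have "\<dots> = (\<Sum>M\<in>pmatchings_with m (Suc h).
        \<Sum>s\<in>unmatched M. q ^ nestings M * q ^ card {t \<in> unmatched M. t < s})"
      unfolding B_def using fin_un
      by (intro sum.Sigma[symmetric] finite_pmatchings_with) (auto simp: pmatchings_with_def)
    also have "\<dots> = (\<Sum>M\<in>pmatchings_with m (Suc h). q ^ nestings M * (\<Sum>i<Suc h. q ^ i))"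
    proof (rule sum.cong[OF refl])
      fix M assume "M \<in> pmatchings_with m (Suc h)"
      then have "finite (unmatched M)" "card (unmatched M) = Suc h"
        using fin_un by (auto simp: pmatchings_with_def)
      then show "(\<Sum>s\<in>unmatched M. q ^ nestings M * q ^ card {t \<in> unmatched M. t < s}) =
          q ^ nestings M * (\<Sum>i<Suc h. q ^ i)"
        using sum_rank[of "unmatched M" q] by (simp flip: sum_distrib_left)
    qed
    also have "\<dots> = down q ((updown q 1 ^^ m) vacuum) h"
      unfolding down_def Suc.IH[symmetric] sum_distrib_right[symmetric] by (rule mult.commute)
    finally show ?thesis .
  qed
  moreover have "(updown q 1 ^^ Suc m) vacuum h =
      down q ((updown q 1 ^^ m) vacuum) h + up ((updown q 1 ^^ m) vacuum) h"
    by simp (simp add: updown_def[of _ _ "(updown q 1 ^^ m) vacuum"])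
  ultimately show ?case by (simp only: add.commute)
qed

text \<open>The inequalities a < c < d < b already orient both edges, so nestings are pairs in
  \<open>edges M\<close>.\<close>

lemma ne_eq_nestings:
  assumes M: "M \<in> pmatchings A" and "finite A" "unmatched M = {}"
  shows "ne M = nestings M"
proof -
  have fin: "finite (edges M)"
    using edges_subset[OF M] assms(2) by (meson finite_SigmaI finite_subset)
  have "{((a, b), (c, d)). {a, b} \<in> M \<and> {c, d} \<in> M \<and> a < c \<and> c < d \<and> d < b} =
      (SIGMA e:edges M. {f \<in> edges M. fst e < fst f \<and> snd f < snd e})"
    by (auto simp: edges_def)
  then show ?thesis
    using fin assms(3) by (simp add: ne_def nestings_def nested_edges_def)
qed

lemma matchings_eq: "matchings n = pmatchings_with (2 * n) 0"
proof -
  have "(\<forall>e\<in>M. card e = 2) \<longleftrightarrow> (\<forall>e\<in>M. card e = 1 \<or> card e = 2) \<and> card (unmatched M) = 0"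
    if "partition_on {1..2 * n} M" for M
  proof -
    have "unmatched M \<subseteq> {1..2 * n}" using that by (auto simp: unmatched_def partition_on_def)
    \<comment> \<open>An infinite set would also have \<open>card\<close> equal to 0.\<close>
    then have "finite (unmatched M)" by (rule finite_subset) simp
    then have "card (unmatched M) = 0 \<longleftrightarrow> (\<forall>e\<in>M. card e \<noteq> 1)"
      by (auto simp: unmatched_def card_1_singleton_iff)
    then show ?thesis by fastforce
  qed
  then show ?thesis by (auto simp: matchings_def pmatchings_with_def pmatchings_def)
qed

lemma sum_ne: "(\<Sum>M\<in>matchings n. q ^ ne M) = mixed q 0 (2 * n)"
proof -
  have "ne M = nestings M" if "M \<in> pmatchings_with (2 * n) 0" for M
  proof (rule ne_eq_nestings)
    show M: "M \<in> pmatchings {1..2 * n}" using that by (simp add: pmatchings_with_def)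
    show "unmatched M = {}"
      using that finite_subset[OF unmatched_subset[OF M]] by (simp add: pmatchings_with_def)
  qed simp
  then show ?thesis using sum_nestings[of q "2 * n" 0] by (simp add: matchings_eq mixed_def)
qed

subsection \<open>From generating functions to a bijection\<close>

text \<open>Bijections between the fibres over each \<open>k\<close> are glued together; distinct
  fibres have disjoint images.\<close>

lemma bij_betw_if_fibres_equinumerous:
  assumes fin: "finite A" "finite B"
    and card: "\<And>k. card {a \<in> A. f a = k} = card {b \<in> B. g b = k}"
  shows "\<exists>\<Phi>. bij_betw \<Phi> A B \<and> (\<forall>a\<in>A. f a = g (\<Phi> a))"
proof -
  have "\<exists>h. bij_betw h {a \<in> A. f a = k} {b \<in> B. g b = k}" for k
    using fin card by (intro finite_same_card_bij) auto
  then obtain h where h: "\<And>k. bij_betw (h k) {a \<in> A. f a = k} {b \<in> B. g b = k}" by metis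
  define \<Phi> where "\<Phi> a = h (f a) a" for a
  have fibre: "\<Phi> a \<in> B \<and> g (\<Phi> a) = f a" if "a \<in> A" for a
    using bij_betwE[OF h, of "f a"] that by (auto simp: \<Phi>_def)
  have "bij_betw \<Phi> A B"
  proof (rule bij_betw_imageI)
    show "inj_on \<Phi> A"
    proof (rule inj_onI)
      fix a a' assume a: "a \<in> A" "a' \<in> A" "\<Phi> a = \<Phi> a'"
      then have "f a = f a'" using fibre by metis
      with a show "a = a'" using bij_betw_imp_inj_on[OF h, of "f a"] by (auto simp: \<Phi>_def inj_on_def)
    qed
    show "\<Phi> ` A = B"
    proof (intro equalityI subsetI)
      fix b assume "b \<in> B"
      then have "b \<in> h (g b) ` {a \<in> A. f a = g b}"
        using bij_betw_imp_surj_on[OF h, of "g b"] by auto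
      then obtain a where "a \<in> A" "f a = g b" "b = h (g b) a" by blast
      then have "a \<in> A" "b = \<Phi> a" by (simp_all add: \<Phi>_def)
      then show "b \<in> \<Phi> ` A" by blast
    qed (use fibre in auto)
  qed
  with fibre show ?thesis by (intro exI[of _ \<Phi>]) auto
qed

text \<open>Taking the indeterminate for \<open>q\<close> turns equality of generating functions
  into equality of all fibre sizes.\<close>

lemma coeff_generating_function:
  assumes "finite A"
  shows "coeff (\<Sum>a\<in>A. [:0, 1 :: int:] ^ f a) k = int (card {a \<in> A. f a = k})"
proof -
  have "[:0, 1 :: int:] ^ m = monom 1 m" for m
    by (simp add: monom_altdef)
  then have "coeff (\<Sum>a\<in>A. [:0, 1 :: int:] ^ f a) k = (\<Sum>a\<in>A. if f a = k then 1 else 0)"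
    by (simp add: coeff_sum coeff_monom)
  also have "\<dots> = int (card {a \<in> A. f a = k})"
    using assms by (simp add: sum.If_cases Int_def)
  finally show ?thesis .
qed

theorem theorem1:
  fixes n :: nat
  assumes "n \<ge> 1"
  shows "\<exists>\<Phi>. bij_betw \<Phi> (wedge_paths n) (matchings n) \<and>
              (\<forall>P\<in>wedge_paths n. north_steps P = ne (\<Phi> P))"
proof (rule bij_betw_if_fibres_equinumerous)
  show fin: "finite (wedge_paths n)" "finite (matchings n)"
    by (simp_all add: wedge_paths_eq finite_heights matchings_eq finite_pmatchings_with)
  show "card {P \<in> wedge_paths n. north_steps P = k} = card {M \<in> matchings n. ne M = k}" for k
    using arg_cong[where f="\<lambda>p. coeff p k",
        OF trans[OF sum_north_steps[OF assms, of "[:0, 1 :: int:]"] sum_ne[symmetric]]]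
    by (simp only: coeff_generating_function[OF fin(1)] coeff_generating_function[OF fin(2)] of_nat_eq_iff)
qed

end
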